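(* Let $n$ be a positive integer. Consider the rational functions $F$ of the following three kinds. (A) Given disjoint Jordan arcs $\gamma_1,\ldots,\gamma_n$ in the complex plane: a rational function $F$ of type $(n+1,n)$ for which there is a compact set $K\subset\mathbf{C}$ bounded by $n$ disjoint Jordan curves such that $F$ is a conformal map from $\mathbf{C}_\infty\setminus K$ onto $\mathbf{C}_\infty\setminus\bigcup_{j=1}^n\gamma_j$ and $F(\infty)=\infty$. (B) Given distinct $\eta_1,\ldots,\eta_{2n}\in\mathbf{C}$: a rational function $F$ of type $(n+1,n)$ whose set of critical values is $\{\eta_1,\ldots,\eta_{2n}\}$. (C) Given distinct $\zeta_1,\ldots,\zeta_{2n}\in\mathbf{C}$: a rational function $F$ of type $(n+1,n)$ whose set of critical points is $\{\zeta_1,\ldots,\zeta_{2n}\}$. The rational functions of kinds (A), (B) and (C) are minimal in the sense that if $F=P/Q$ with coprime polynomials $P,Q$, then neither $\deg(P)<n+1$ nor $\deg(Q)<n$ can occur. Moreover, they have only simple poles.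
   Context: $\mathbf{C}_\infty=\mathbf{C}\cup\{\infty\}$ is the extended complex plane. A rational function is of type $(n,m)$ if it can be written as $P/Q$ with coprime polynomials $P,Q$ such that $\deg(P)=n$ and $\deg(Q)=m$. Jordan arcs and Jordan curves are homeomorphic images of the interval $[0,1]$ and of the unit circle, respectively. A conformal map is always understood to be injective. The critical points of $F$ are the elements of $\{z\in\mathbf{C}:F'(z)=0\}$, and the critical values of $F$ are the elements of $\{F(z):z\in\mathbf{C}\text{ with }F'(z)=0\}$. *)

theory Defs
  imports "HOL-Complex_Analysis.Complex_Analysis"
    "HOL-Computational_Algebra.Computational_Algebra"
begin

text \<open>
  A rational function is represented by a function on \<open>complex\<close>. Since \<open>x / 0 = 0\<close>, it takes the
  conventional value \<open>0\<close> at its poles; \<open>sphere_map\<close> below puts \<open>\<infinity>\<close> there instead.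
\<close>

definition coprime_quotient ::
    "(complex \<Rightarrow> complex) \<Rightarrow> complex poly \<Rightarrow> complex poly \<Rightarrow> bool" where
  "coprime_quotient F P Q \<longleftrightarrow>
     Q \<noteq> 0 \<and> coprime P Q \<and> F = (\<lambda>z. poly P z / poly Q z)"

definition rational_of_type :: "(complex \<Rightarrow> complex) \<Rightarrow> nat \<Rightarrow> nat \<Rightarrow> bool" where
  "rational_of_type F p q \<longleftrightarrow>
     (\<exists>P Q. coprime_quotient F P Q \<and> degree P = p \<and> degree Q = q)"

text \<open>
  A pole is not a critical point: \<open>F\<close> is not continuous there, so it has no derivative.
\<close>

definition critical_points :: "(complex \<Rightarrow> complex) \<Rightarrow> complex set" where
  "critical_points F = {z. (F has_field_derivative 0) (at z)}"

definition critical_values :: "(complex \<Rightarrow> complex) \<Rightarrow> complex set" where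
  "critical_values F = F ` critical_points F"

text \<open>The order of a pole at \<open>\<infinity>\<close> is read off in the coordinate \<open>w = 1 / z\<close>.\<close>

definition only_simple_poles :: "(complex \<Rightarrow> complex) \<Rightarrow> bool" where
  "only_simple_poles F \<longleftrightarrow>
     (\<forall>z. is_pole F z \<longrightarrow> zorder F z = -1) \<and>
     (is_pole (\<lambda>w. F (1 / w)) 0 \<longrightarrow> zorder (\<lambda>w. F (1 / w)) 0 = -1)"

text \<open>The extended complex plane; \<open>None\<close> is the point \<open>\<infinity>\<close>.\<close>

type_synonym csphere = "complex option"

fun sphere_map :: "(complex \<Rightarrow> complex) \<Rightarrow> csphere \<Rightarrow> csphere" where
  "sphere_map F (Some z) = (if is_pole F z then None else Some (F z))"
| "sphere_map F None =
     (if filterlim F at_infinity at_infinity then None else Some (Lim at_infinity F))"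

text \<open>
  \<open>sphere_chart p\<close> is a holomorphic parametrization around \<open>p\<close>, sending \<open>0\<close> to \<open>p\<close>. A map is
  analytic at \<open>p\<close> if its expression \<open>g\<close> in the charts around \<open>p\<close> and \<open>f p\<close> is analytic at \<open>0\<close>.
\<close>

fun sphere_chart :: "csphere \<Rightarrow> complex \<Rightarrow> csphere" where
  "sphere_chart (Some a) w = Some (a + w)"
| "sphere_chart None w = (if w = 0 then None else Some (1 / w))"

definition sphere_analytic_at :: "(csphere \<Rightarrow> csphere) \<Rightarrow> csphere \<Rightarrow> bool" where
  "sphere_analytic_at f p \<longleftrightarrow>
     (\<exists>g. g analytic_on {0} \<and>
          (\<forall>\<^sub>F w in nhds 0. f (sphere_chart p w) = sphere_chart (f p) (g w)))"

definition conformal_map_onto ::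
    "(csphere \<Rightarrow> csphere) \<Rightarrow> csphere set \<Rightarrow> csphere set \<Rightarrow> bool" where
  "conformal_map_onto f S T \<longleftrightarrow>
     (\<forall>p\<in>S. sphere_analytic_at f p) \<and> inj_on f S \<and> f ` S = T"

definition jordan_arc :: "complex set \<Rightarrow> bool" where
  "jordan_arc A \<longleftrightarrow> A homeomorphic {0..1::real}"

definition jordan_curve :: "complex set \<Rightarrow> bool" where
  "jordan_curve A \<longleftrightarrow> A homeomorphic sphere (0::complex) 1"

definition bounded_by_jordan_curves :: "complex set \<Rightarrow> nat \<Rightarrow> bool" where
  "bounded_by_jordan_curves K n \<longleftrightarrow>
     (\<exists>C. (\<forall>j\<in>{1..n}. jordan_curve (C j)) \<and> disjoint_family_on C {1..n} \<and>
          frontier K = (\<Union>j\<in>{1..n}. C j))"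

definition kind_A :: "nat \<Rightarrow> (nat \<Rightarrow> complex set) \<Rightarrow> (complex \<Rightarrow> complex) \<Rightarrow> bool" where
  "kind_A n \<gamma> F \<longleftrightarrow>
     rational_of_type F (n + 1) n \<and>
     (\<exists>K. compact K \<and> bounded_by_jordan_curves K n \<and>
          conformal_map_onto (sphere_map F)
            (- (Some ` K)) (- (Some ` (\<Union>j\<in>{1..n}. \<gamma> j))) \<and>
          sphere_map F None = None)"

definition kind_B :: "nat \<Rightarrow> (nat \<Rightarrow> complex) \<Rightarrow> (complex \<Rightarrow> complex) \<Rightarrow> bool" where
  "kind_B n \<eta> F \<longleftrightarrow>
     rational_of_type F (n + 1) n \<and> critical_values F = \<eta> ` {1..2 * n}"

definition kind_C :: "nat \<Rightarrow> (nat \<Rightarrow> complex) \<Rightarrow> (complex \<Rightarrow> complex) \<Rightarrow> bool" where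
  "kind_C n \<zeta> F \<longleftrightarrow>
     rational_of_type F (n + 1) n \<and> critical_points F = \<zeta> ` {1..2 * n}"

end

theory Submission
  imports Defs "HOL-Computational_Algebra.Field_as_Ring"
begin

text \<open>
  Two coprime representations of the same function agree as fractions of polynomials, so their
  degrees agree; this is the minimality. Write \<open>F = P / Q\<close> with \<open>degree P = n + 1\<close> and
  \<open>degree Q = n\<close>. The pole at \<open>\<infinity>\<close> has order \<open>(n + 1) - n = 1\<close>, and the finite poles are the
  zeros of \<open>Q\<close> with the same multiplicities, so what remains is that \<open>Q\<close> has no double zero
  (\<open>only_simple_poles_quotient\<close>).

  For the kinds (B) and (C) this is a count. Critical points of \<open>F\<close> are zeros of
  \<open>P' Q - P Q'\<close>, which has degree exactly \<open>2 n\<close>. Since \<open>2 n\<close> distinct critical points or critical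
  values are prescribed, every zero of that polynomial is a critical point. A double zero of \<open>Q\<close>
  would be a further zero, and it is a pole rather than a critical point
  (\<open>rsquarefree_denominator_if_many_critical_points\<close>).

  For the kind (A) it suffices to find \<open>n\<close> distinct zeros of \<open>Q\<close>, one inside each of the curves
  \<open>C 1, ..., C n\<close> that make up the frontier of \<open>K\<close>. Let \<open>\<Gamma>\<close> be the union of the arcs. It does not
  separate the plane, and \<open>F\<close> maps \<open>- K\<close> homeomorphically onto \<open>- \<Gamma>\<close>, so \<open>- K\<close> is connected. This
  forces the insides of the curves to be pairwise disjoint
  (\<open>disjoint_insides_of_frontier_curves\<close>). Because \<open>F\<close> is already a bijection from \<open>- K\<close> onto
  \<open>- \<Gamma>\<close>, the open mapping theorem leaves no value outside \<open>\<Gamma>\<close> for the frontier of \<open>K\<close>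
  (\<open>quotient_maps_frontier_into_omitted_set\<close>). If there were no pole inside \<open>C j\<close>, the image of
  that inside would be a bounded open set with frontier in \<open>\<Gamma>\<close>. As \<open>- \<Gamma>\<close> is connected and
  unbounded, the image would then lie in \<open>\<Gamma>\<close>, which has empty interior
  (\<open>no_open_map_with_boundary_in_nonseparating_set\<close>).
\<close>

section \<open>Coprime quotients of polynomials\<close>

lemma coprime_poly_no_common_root:
  fixes P Q :: "'a::field poly"
  assumes "coprime P Q" "poly Q a = 0"
  shows "poly P a \<noteq> 0"
proof
  assume "poly P a = 0"
  with assms(2) have "[:-a, 1:] dvd P" "[:-a, 1:] dvd Q"
    by (simp_all add: poly_eq_0_iff_dvd)
  with assms(1) have "is_unit [:-a, 1:]"
    by (rule coprime_common_divisor)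
  thus False
    by (simp add: is_unit_poly_iff)
qed

lemma is_pole_coprime_quotient_iff:
  assumes F: "coprime_quotient F P Q"
  shows "is_pole F z \<longleftrightarrow> poly Q z = 0"
proof
  have cop: "coprime P Q" and Q0: "Q \<noteq> 0" and Feq: "F = (\<lambda>z. poly P z / poly Q z)"
    using F unfolding coprime_quotient_def by auto
  show "poly Q z = 0" if "is_pole F z"
  proof (rule ccontr)
    assume "poly Q z \<noteq> 0"
    then have "F analytic_on {z}"
      unfolding Feq analytic_at
      by (intro exI[of _ "{z. poly Q z \<noteq> 0}"])
         (auto intro!: holomorphic_intros open_Collect_neq continuous_intros)
    with that show False
      using analytic_at_imp_no_pole by blast
  qed
  show "is_pole F z" if "poly Q z = 0"
    unfolding Feq
  proof (rule is_pole_divide)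
    have "open (- ({w. poly Q w = 0} - {z}))"
      using poly_roots_finite[OF Q0] by (intro open_Compl finite_imp_closed) auto
    then have "eventually (\<lambda>w. w \<in> - ({w. poly Q w = 0} - {z}) - {z}) (at z)"
      by (intro eventually_at_in_open) auto
    then have "eventually (\<lambda>w. poly Q w \<noteq> 0) (at z)"
      by eventually_elim auto
    moreover have "poly Q \<midarrow>z\<rightarrow> 0"
      using that by (auto intro!: tendsto_eq_intros)
    ultimately show "filterlim (poly Q) (at 0) (at z)"
      by (simp add: filterlim_at)
    show "poly P z \<noteq> 0"
      by (rule coprime_poly_no_common_root[OF cop that])
  qed auto
qed

lemma coprime_quotient_holomorphic_on:
  assumes "coprime_quotient F P Q"
  shows "F holomorphic_on {z. poly Q z \<noteq> 0}"
  using assms unfolding coprime_quotient_def by (auto intro!: holomorphic_intros)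

text \<open>
  The two fractions agree off the finitely many zeros of the denominators, hence
  \<open>P Q' = P' Q\<close>; coprimality turns this into mutual divisibility of the denominators.
\<close>

lemma coprime_quotient_degree_unique:
  assumes "coprime_quotient F P Q" "coprime_quotient F P' Q'"
  shows "degree P = degree P'" "degree Q = degree Q'"
proof -
  have Q: "Q \<noteq> 0" "Q' \<noteq> 0" "coprime P Q" "coprime P' Q'"
    and eq: "poly P z / poly Q z = poly P' z / poly Q' z" for z
    using assms unfolding coprime_quotient_def by (simp_all, metis)
  have "finite ({z. poly Q z = 0} \<union> {z. poly Q' z = 0})"
    using Q by (simp add: poly_roots_finite)
  then have "infinite (- ({z. poly Q z = 0} \<union> {z. poly Q' z = 0}))"
    using infinite_UNIV_char_0 by (metis Compl_eq_Diff_UNIV Diff_infinite_finite)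
  moreover have "- ({z. poly Q z = 0} \<union> {z. poly Q' z = 0}) \<subseteq> {z. poly (P * Q' - P' * Q) z = 0}"
  proof
    fix z assume "z \<in> - ({z. poly Q z = 0} \<union> {z. poly Q' z = 0})"
    then show "z \<in> {z. poly (P * Q' - P' * Q) z = 0}"
      using eq[of z] by (simp add: frac_eq_eq)
  qed
  ultimately have "P * Q' - P' * Q = 0"
    using poly_roots_finite finite_subset by blast
  then have PQ: "P * Q' = P' * Q"
    by simp
  have "Q dvd P * Q'" "Q' dvd P' * Q"
    using PQ by (metis dvd_triv_right)+
  moreover have "coprime Q P" "coprime Q' P'"
    using Q by (simp_all add: coprime_commute)
  ultimately have "Q dvd Q'" "Q' dvd Q"
    using coprime_dvd_mult_right_iff[of Q P Q'] coprime_dvd_mult_right_iff[of Q' P' Q] by blast+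
  then have "degree Q \<le> degree Q'" "degree Q' \<le> degree Q"
    using Q by (simp_all add: dvd_imp_degree_le)
  then show degQ: "degree Q = degree Q'"
    by simp
  show "degree P = degree P'"
  proof (cases "P = 0 \<or> P' = 0")
    case True
    with PQ Q have "P = 0" "P' = 0"
      by auto
    then show ?thesis
      by simp
  next
    case False
    then have "degree P + degree Q' = degree P' + degree Q"
      using arg_cong[OF PQ, of degree] Q by (simp add: degree_mult_eq)
    then show ?thesis
      using degQ by simp
  qed
qed

text \<open>
  If \<open>a\<close> is a multiple root, then \<open>Q\<close> and \<open>Q / (x - a)\<close> have the same set of roots, which the
  smaller degree bounds.
\<close>

lemma rsquarefree_if_enough_roots:
  fixes Q :: "'a::field_char_0 poly"
  assumes "Q \<noteq> 0" "degree Q \<le> card {z. poly Q z = 0}"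
  shows "rsquarefree Q"
  unfolding rsquarefree_roots
proof (intro allI notI)
  fix a assume a: "poly Q a = 0 \<and> poly (pderiv Q) a = 0"
  then obtain R where R: "Q = [:-a, 1:] * R"
    by (auto simp: poly_eq_0_iff_dvd elim: dvdE)
  have Ra: "poly R a = 0"
    using a unfolding R pderiv_mult by (simp add: pderiv_pCons)
  have R0: "R \<noteq> 0"
    using assms(1) R by auto
  have "{z. poly Q z = 0} = {z. poly R z = 0}"
    using Ra by (auto simp: R)
  then have "card {z. poly Q z = 0} \<le> degree R"
    using card_poly_roots_bound[OF R0] by simp
  moreover have "degree Q = degree R + 1"
    using R0 by (subst R, subst degree_mult_eq) auto
  ultimately show False
    using assms(2) by simp
qed

text \<open>
  At a zero \<open>z\<close> of \<open>Q = (x - z) R\<close> the function is \<open>P / R\<close> times the inverse of \<open>x - z\<close>. At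
  infinity, the reversed polynomials give \<open>F (1 / w)\<close> as \<open>w\<close> to the power
  \<open>degree Q - degree P\<close> times a function that is analytic and nonzero at \<open>0\<close>.
\<close>

lemma only_simple_poles_quotient:
  assumes F: "coprime_quotient F P Q" and deg: "degree P = degree Q + 1"
    and sf: "rsquarefree Q"
  shows "only_simple_poles F"
  unfolding only_simple_poles_def
proof (intro conjI allI impI)
  have cop: "coprime P Q" and Feq: "F = (\<lambda>z. poly P z / poly Q z)"
    using F unfolding coprime_quotient_def by auto
  fix z assume pole: "is_pole F z"
  have Qz: "poly Q z = 0"
    using pole is_pole_coprime_quotient_iff[OF F] by blast
  then obtain R where R: "Q = [:-z, 1:] * R"
    by (auto simp: poly_eq_0_iff_dvd elim: dvdE)
  have "poly (pderiv Q) z \<noteq> 0"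
    using sf Qz by (auto simp: rsquarefree_roots)
  then have Rz: "poly R z \<noteq> 0"
    unfolding R pderiv_mult by (simp add: pderiv_pCons)
  show "zorder F z = -1"
  proof (rule zorder_eqI)
    show "open {w. poly R w \<noteq> 0}"
      by (intro open_Collect_neq continuous_intros)
    show "z \<in> {w. poly R w \<noteq> 0}"
      using Rz by simp
    show "(\<lambda>w. poly P w / poly R w) holomorphic_on {w. poly R w \<noteq> 0}"
      by (intro holomorphic_intros) auto
    show "poly P z / poly R z \<noteq> 0"
      using coprime_poly_no_common_root[OF cop Qz] Rz by simp
    fix w assume "w \<in> {w. poly R w \<noteq> 0}" "w \<noteq> z"
    then show "F w = poly P w / poly R w * (w - z) powi -1"
      by (simp add: Feq R power_int_minus field_simps)
  qed
next
  have Q0: "Q \<noteq> 0" and Feq: "F = (\<lambda>z. poly P z / poly Q z)"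
    using F unfolding coprime_quotient_def by auto
  let ?P = "reflect_poly P" and ?Q = "reflect_poly Q"
  show "zorder (\<lambda>w. F (1 / w)) 0 = -1"
  proof (rule zorder_eqI)
    show "open {w. poly ?Q w \<noteq> 0}"
      by (intro open_Collect_neq continuous_intros)
    show "0 \<in> {w. poly ?Q w \<noteq> 0}"
      using Q0 by simp
    show "(\<lambda>w. poly ?P w / poly ?Q w) holomorphic_on {w. poly ?Q w \<noteq> 0}"
      by (intro holomorphic_intros) auto
    have "P \<noteq> 0"
      using deg by auto
    then show "poly ?P 0 / poly ?Q 0 \<noteq> 0"
      using Q0 by simp
    fix w :: complex assume "w \<in> {w. poly ?Q w \<noteq> 0}" "w \<noteq> 0"
    then show "F (1 / w) = poly ?P w / poly ?Q w * (w - 0) powi -1"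
      by (simp add: Feq poly_reflect_poly_nz deg power_int_minus field_simps)
  qed
qed

section \<open>Many critical points force simple poles\<close>

text \<open>
  At the exponent \<open>degree P + degree Q - 1\<close> the coefficients of the two products are
  \<open>degree P\<close> and \<open>degree Q\<close> times the same nonzero number, so they do not cancel in
  characteristic \<open>0\<close>.
\<close>

lemma degree_wronskian:
  fixes P Q :: "'a::field_char_0 poly"
  assumes "degree Q < degree P" "Q \<noteq> 0"
  shows "degree (pderiv P * Q - P * pderiv Q) = degree P + degree Q - 1"
    "pderiv P * Q - P * pderiv Q \<noteq> 0"
proof -
  let ?W = "pderiv P * Q - P * pderiv Q" and ?d = "degree P + degree Q - 1"
  have le1: "degree (pderiv P * Q) \<le> ?d"
    using degree_mult_le[of "pderiv P" Q] assms(1) by (simp add: degree_pderiv)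
  have le2: "degree (P * pderiv Q) \<le> ?d"
  proof (cases "degree Q = 0")
    case True
    then have "pderiv Q = 0"
      by (simp add: pderiv_eq_0_iff)
    then show ?thesis
      using True by simp
  next
    case False
    then show ?thesis
      using degree_mult_le[of P "pderiv Q"] by (simp add: degree_pderiv)
  qed
  have c1: "coeff (pderiv P * Q) ?d = of_nat (degree P) * (lead_coeff P * lead_coeff Q)"
  proof -
    have "?d = degree (pderiv P) + degree Q"
      using assms(1) by (simp add: degree_pderiv)
    then have "coeff (pderiv P * Q) ?d = lead_coeff (pderiv P) * lead_coeff Q"
      by (simp add: coeff_mult_degree_sum)
    then show ?thesis
      using assms(1) by (simp add: coeff_pderiv degree_pderiv)
  qed
  have c2: "coeff (P * pderiv Q) ?d = of_nat (degree Q) * (lead_coeff P * lead_coeff Q)"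
  proof (cases "degree Q = 0")
    case True
    then have "pderiv Q = 0"
      by (simp add: pderiv_eq_0_iff)
    then show ?thesis
      using True by simp
  next
    case False
    then have "?d = degree P + degree (pderiv Q)"
      by (simp add: degree_pderiv)
    then have "coeff (P * pderiv Q) ?d = lead_coeff P * lead_coeff (pderiv Q)"
      by (simp add: coeff_mult_degree_sum)
    then show ?thesis
      using False by (simp add: coeff_pderiv degree_pderiv)
  qed
  have "coeff ?W ?d = (of_nat (degree P) - of_nat (degree Q)) * (lead_coeff P * lead_coeff Q)"
    using c1 c2 by (simp add: algebra_simps)
  moreover have "P \<noteq> 0"
    using assms(1) by auto
  ultimately have nz: "coeff ?W ?d \<noteq> 0"
    using assms by simp
  then show "?W \<noteq> 0"
    by (metis coeff_0)
  show "degree ?W = ?d"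
    using le_degree[OF nz] degree_diff_le[OF le1 le2] by linarith
qed

text \<open>
  A pole is excluded although \<open>F\<close> has the conventional value \<open>0\<close> there: a function with a derivative
  is continuous, and \<open>F\<close> is unbounded near a pole. Elsewhere the quotient rule applies.
\<close>

lemma critical_point_quotient:
  assumes F: "coprime_quotient F P Q" and z: "z \<in> critical_points F"
  shows "poly Q z \<noteq> 0" "poly (pderiv P * Q - P * pderiv Q) z = 0"
proof -
  have Feq: "F = (\<lambda>z. poly P z / poly Q z)"
    using F unfolding coprime_quotient_def by auto
  have D0: "(F has_field_derivative 0) (at z)"
    using z unfolding critical_points_def by simp
  show Qz: "poly Q z \<noteq> 0"
  proof
    assume "poly Q z = 0"
    then have "filterlim F at_infinity (at z)"
      using is_pole_coprime_quotient_iff[OF F] unfolding is_pole_def by blast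
    moreover have "F \<midarrow>z\<rightarrow> F z"
      using DERIV_isCont[OF D0] by (simp add: isCont_def)
    ultimately show False
      using not_tendsto_and_filterlim_at_infinity[of "at z" F "F z"] by auto
  qed
  have "(F has_field_derivative
      (poly (pderiv P) z * poly Q z - poly P z * poly (pderiv Q) z) / (poly Q z * poly Q z)) (at z)"
    unfolding Feq using Qz by (intro DERIV_divide poly_DERIV)
  from DERIV_unique[OF D0 this] Qz
  show "poly (pderiv P * Q - P * pderiv Q) z = 0"
    by simp
qed

lemma finite_critical_points_quotient:
  assumes F: "coprime_quotient F P Q" and deg: "degree Q < degree P"
  shows "finite (critical_points F)"
proof (rule finite_subset)
  show "critical_points F \<subseteq> {z. poly (pderiv P * Q - P * pderiv Q) z = 0}"
    using critical_point_quotient(2)[OF F] by blast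
  show "finite {z. poly (pderiv P * Q - P * pderiv Q) z = 0}"
    using F deg by (intro poly_roots_finite degree_wronskian(2)) (auto simp: coprime_quotient_def)
qed

text \<open>
  A double root \<open>a\<close> of \<open>Q\<close> is a root of \<open>P' Q - P Q'\<close>, but it is not a critical point. So it would
  leave at most \<open>degree P + degree Q - 2\<close> roots for the critical points.
\<close>

lemma rsquarefree_denominator_if_many_critical_points:
  assumes F: "coprime_quotient F P Q" and deg: "degree Q < degree P"
    and card: "degree P + degree Q \<le> card (critical_points F) + 1"
  shows "rsquarefree Q"
  unfolding rsquarefree_roots
proof (intro allI notI)
  fix a assume a: "poly Q a = 0 \<and> poly (pderiv Q) a = 0"
  let ?W = "pderiv P * Q - P * pderiv Q"
  have W: "degree ?W = degree P + degree Q - 1" "?W \<noteq> 0"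
    using degree_wronskian deg F by (auto simp: coprime_quotient_def)
  have "insert a (critical_points F) \<subseteq> {z. poly ?W z = 0}" "a \<notin> critical_points F"
    using a critical_point_quotient[OF F] by auto
  moreover have "finite (critical_points F)"
    using F deg by (rule finite_critical_points_quotient)
  ultimately have "card (critical_points F) + 1 \<le> card {z. poly ?W z = 0}"
    using card_mono[OF poly_roots_finite[OF W(2)], of "insert a (critical_points F)"] by simp
  also have "\<dots> \<le> degree P + degree Q - 1"
    using card_poly_roots_bound[OF W(2)] W(1) by simp
  finally show False
    using card deg by linarith
qed

section \<open>Plane topology\<close>

text \<open>
  An open piece of the plane inside an arc would embed into the line, against invariance of
  dimension.
\<close>

lemma jordan_arc_closed_nowhere_dense_nonseparating:
  assumes "jordan_arc A"
  shows "compact A" "connected (- A)" "interior A = {}"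
proof -
  have hom: "A homeomorphic {0..1::real}"
    using assms unfolding jordan_arc_def .
  show "compact A"
    using homeomorphic_compactness[OF hom] by simp
  show "connected (- A)"
    using connected_complement_homeomorphic_interval[of A "0::real" 1] hom by simp
  show "interior A = {}"
  proof (rule ccontr)
    assume ne: "interior A \<noteq> {}"
    obtain f where f: "continuous_on A f" "inj_on f A" "f ` A = {0..1::real}"
      using hom unfolding homeomorphic_def
      by (metis homeomorphism_def homeomorphism_injective_closed_map inj_on_def)
    then have "DIM(complex) \<le> DIM(real)"
      using ne continuous_on_subset[OF f(1) interior_subset] inj_on_subset[OF f(2) interior_subset]
      by (intro invariance_of_dimension[of "interior A" f]) auto
    then show False
      by simp
  qed
qed

text \<open>
  Arcs are added one at a time. Janiszewski's theorem says that two compact sets, neither of which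
  separates the plane, have a nonseparating union if their intersection is connected; here the
  intersection is empty.
\<close>

lemma disjoint_jordan_arcs_nonseparating:
  assumes "finite J" "\<And>j. j \<in> J \<Longrightarrow> jordan_arc (\<gamma> j)" "disjoint_family_on \<gamma> J"
  shows "compact (\<Union>j\<in>J. \<gamma> j) \<and> connected (- (\<Union>j\<in>J. \<gamma> j)) \<and> interior (\<Union>j\<in>J. \<gamma> j) = {}"
  using assms
proof (induction J rule: finite_induct)
  case empty
  show ?case by (simp add: connected_UNIV)
next
  case (insert i J)
  let ?G = "\<Union>j\<in>J. \<gamma> j"
  have IH: "compact ?G" "connected (- ?G)" "interior ?G = {}"
    using insert by (auto simp: disjoint_family_on_def)
  have i: "compact (\<gamma> i)" "connected (- \<gamma> i)" "interior (\<gamma> i) = {}"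
    using insert jordan_arc_closed_nowhere_dense_nonseparating by auto
  have disj: "\<gamma> i \<inter> ?G = {}"
    using insert by (fastforce simp: disjoint_family_on_def)
  have "connected (- (\<gamma> i \<union> ?G))"
    using IH i disj by (intro Janiszewski_connected) (auto simp: compact_imp_closed)
  moreover have "interior (\<gamma> i \<union> ?G) = {}"
    using interior_closed_Un_empty_interior[of "\<gamma> i" ?G] IH i by (simp add: compact_imp_closed)
  ultimately show ?case
    using IH i by (simp add: compact_Un)
qed

lemma jordan_curve_inside_nonempty:
  assumes "jordan_curve A"
  shows "compact A" "inside A \<noteq> {}"
proof -
  have hom: "A homeomorphic sphere (0::complex) 1"
    using assms unfolding jordan_curve_def .
  show comp: "compact A"
    using homeomorphic_compactness[OF hom] by simp
  show "inside A \<noteq> {}"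
  proof
    assume "inside A = {}"
    then have "- A = outside A"
      using inside_Un_outside[of A] by simp
    then have "connected (- A)"
      using connected_outside[of A] comp by (simp add: compact_imp_bounded)
    then show False
      using Jordan_Brouwer_separation[OF hom] by simp
  qed
qed

lemma connected_unbounded_subset_outside:
  assumes "connected U" "\<not> bounded U" "U \<inter> A = {}"
  shows "U \<subseteq> outside A"
proof
  fix x assume "x \<in> U"
  then have "U \<subseteq> connected_component_set (- A) x"
    using assms by (intro connected_component_maximal) auto
  then have "\<not> bounded (connected_component_set (- A) x)"
    using assms(2) bounded_subset by blast
  then show "x \<in> outside A"
    by (simp add: outside)
qed

text \<open>
  At a common point \<open>x\<close> of the insides, the component of \<open>- A\<close> misses \<open>B\<close> and the component of
  \<open>- B\<close> misses \<open>A\<close>. Being maximal, they coincide, and their frontier lies in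
  \<open>A \<inter> B = {}\<close>. But a nonempty bounded set has a nonempty frontier.
\<close>

lemma inside_disjoint_if_mutually_outside:
  fixes A B :: "'a::euclidean_space set"
  assumes "closed A" "closed B" "A \<inter> B = {}" "A \<subseteq> outside B" "B \<subseteq> outside A"
  shows "inside A \<inter> inside B = {}"
proof (rule ccontr)
  assume "inside A \<inter> inside B \<noteq> {}"
  then obtain x where x: "x \<in> inside A" "x \<in> inside B"
    by auto
  let ?V = "connected_component_set (- A) x" and ?W = "connected_component_set (- B) x"
  have xAB: "x \<in> - A" "x \<in> - B"
    using x by (auto simp: inside_def)
  have sub: "connected_component_set (- S) x \<subseteq> - T" if "x \<in> inside S" "T \<subseteq> outside S" for S T
    using that by (metis ComplI disjoint_iff inside_Int_outside inside_same_component mem_Collect_eq subset_iff)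
  have "?V \<subseteq> ?W" "?W \<subseteq> ?V"
    using sub[OF x(1) assms(5)] sub[OF x(2) assms(4)] xAB
    by (intro connected_component_maximal; simp)+
  then have VW: "?V = ?W"
    by blast
  have "frontier ?V \<subseteq> A" "frontier ?W \<subseteq> B"
    using frontier_of_connected_component_subset[of "- A" x]
      frontier_of_connected_component_subset[of "- B" x] assms(1,2)
    by (auto simp: frontier_complement dest: frontier_subset_closed)
  then have "frontier ?V = {}"
    using VW assms(3) by auto
  moreover have "x \<in> ?V"
    using xAB(1) by (simp only: mem_Collect_eq connected_component_refl)
  moreover have "bounded ?V"
    using x(1) by (simp add: inside_def)
  ultimately show False
    using frontier_not_empty[of ?V] not_bounded_UNIV by (metis empty_iff)
qed

text \<open>
  Connectedness of \<open>- K\<close> excludes nested curves, as for an annulus. The unbounded connected set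
  \<open>- K\<close> lies outside each curve, and each curve consists of limit points of \<open>- K\<close>. So
  each curve lies outside every other one.
\<close>

lemma disjoint_insides_of_frontier_curves:
  fixes K :: "complex set"
  assumes "compact K" and conK: "connected (- K)"
    and clC: "\<And>j. j \<in> J \<Longrightarrow> closed (C j)" and disjC: "disjoint_family_on C J"
    and frK: "frontier K = (\<Union>j\<in>J. C j)"
  shows "disjoint_family_on (\<lambda>j. inside (C j)) J"
  unfolding disjoint_family_on_def
proof (intro ballI impI)
  fix i j assume ij: "i \<in> J" "j \<in> J" "i \<noteq> j"
  have disj: "C i \<inter> C j = {}" if "i \<in> J" "j \<in> J" "i \<noteq> j" for i j
    using disjC that by (simp add: disjoint_family_on_def)
  have unb: "\<not> bounded (- K)"
    using \<open>compact K\<close> cobounded_imp_unbounded compact_imp_bounded by auto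
  have "frontier K \<subseteq> K"
    using \<open>compact K\<close> by (simp add: compact_imp_closed frontier_subset_closed)
  then have out: "- K \<subseteq> outside (C j)" if "j \<in> J" for j
    using frK that by (intro connected_unbounded_subset_outside conK unb) auto
  have CC: "C i \<subseteq> outside (C j)" if "i \<in> J" "j \<in> J" "i \<noteq> j" for i j
  proof -
    have "C i \<subseteq> closure (- K)"
      using frK that by (auto simp: frontier_closures)
    also have "\<dots> \<subseteq> closure (outside (C j))"
      using out that by (intro closure_mono) auto
    also have "\<dots> \<subseteq> C j \<union> outside (C j)"
      using clC that by (intro closure_outside_subset) auto
    finally show ?thesis
      using disj[OF that] by auto
  qed
  show "inside (C i) \<inter> inside (C j) = {}"
    using ij by (intro inside_disjoint_if_mutually_outside clC CC disj) auto
qed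

section \<open>Boundary behaviour\<close>

text \<open>
  If the value \<open>f z\<close> were also taken at some \<open>w\<close> in \<open>S\<close>, the images of small neighbourhoods of \<open>w\<close>
  would be neighbourhoods of \<open>f z\<close>. Points of \<open>S\<close> close to \<open>z\<close> would then share their values with
  points close to \<open>w\<close>.
\<close>

lemma injective_holomorphic_frontier_value:
  assumes holf: "f holomorphic_on S" and "open S" and inj: "inj_on f S"
    and z: "z \<in> frontier S" and cont: "isCont f z"
  shows "f z \<notin> f ` S"
proof
  assume "f z \<in> f ` S"
  then obtain w where w: "w \<in> S" "f z = f w"
    by auto
  have "z \<notin> S"
    using z \<open>open S\<close> by (simp add: frontier_def interior_open)
  with w have "z \<noteq> w"
    by auto
  then obtain U V where UV: "open U" "open V" "z \<in> U" "w \<in> V" "U \<inter> V = {}"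
    using hausdorff by metis
  have "open (f ` (S \<inter> V))"
    using holf \<open>open S\<close> UV inj
    by (intro open_mapping_thm3) (auto intro: holomorphic_on_subset inj_on_subset)
  moreover have "f z \<in> f ` (S \<inter> V)"
    using w UV by auto
  ultimately have "eventually (\<lambda>x. f x \<in> f ` (S \<inter> V)) (nhds z)"
    using cont by (metis continuous_at eventually_nhds_x_imp_x filterlim_iff isCont_def
        tendsto_at_iff_tendsto_nhds topological_tendstoD)
  moreover have "eventually (\<lambda>x. x \<in> U) (nhds z)"
    using UV by (simp add: eventually_nhds_in_open)
  ultimately have "eventually (\<lambda>x. f x \<in> f ` (S \<inter> V) \<and> x \<in> U) (nhds z)"
    by (rule eventually_conj)
  then obtain N where N: "open N" "z \<in> N" "\<And>x. x \<in> N \<Longrightarrow> f x \<in> f ` (S \<inter> V) \<and> x \<in> U"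
    unfolding eventually_nhds by auto
  have "z \<in> closure S"
    using z by (simp add: frontier_def)
  then obtain x where x: "x \<in> S" "x \<in> N"
    using N by (metis IntE closure_iff_nhds_not_empty ex_in_conv subset_refl)
  with N(3) obtain v where "v \<in> S" "v \<in> V" "f x = f v"
    by blast
  with inj x N(3) UV show False
    by (metis disjoint_iff inj_onD)
qed

text \<open>
  The previous argument for the value \<open>\<infinity>\<close>: large values are already taken near \<open>\<infinity>\<close>. To see this
  without working at infinity, fix a circle of radius \<open>R\<close> around \<open>K\<close> and let \<open>?E\<close> be the exterior
  of a disk that contains \<open>\<Gamma>\<close> and the image of the circle. The preimage of \<open>?E\<close> in \<open>- K\<close> is
  connected, avoids the circle and has points beyond it, so it lies entirely beyond the circle.
  Near a pole on the frontier of \<open>K\<close> it would also have points within the circle.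
\<close>

lemma no_pole_on_frontier:
  fixes f :: "complex \<Rightarrow> complex"
  assumes "compact K" "compact \<Gamma>" and cont: "continuous_on (- K) f" and inj: "inj_on f (- K)"
    and im: "f ` (- K) = - \<Gamma>"
    and inf: "filterlim f at_infinity at_infinity"
    and z: "z \<in> frontier K"
  shows "\<not> is_pole f z"
proof
  assume pole: "is_pole f z"
  have "open (- K)"
    using assms by (simp add: compact_imp_closed open_Compl)
  then obtain g where g: "homeomorphism (- K) (- \<Gamma>) f g"
    using invariance_of_domain_homeomorphism[of "- K" f] cont inj im by auto
  obtain R where R: "K \<subseteq> ball 0 R" "0 < R"
    using \<open>compact K\<close> bounded_subset_ballD compact_imp_bounded by metis
  have "compact (f ` sphere 0 R)"
    using R by (intro compact_continuous_image continuous_on_subset[OF cont]) auto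
  then have "bounded (f ` sphere 0 R \<union> \<Gamma>)"
    using \<open>compact \<Gamma>\<close> by (simp add: compact_imp_bounded)
  then obtain M where M: "f ` sphere 0 R \<union> \<Gamma> \<subseteq> ball 0 M"
    using bounded_subset_ballD by metis
  let ?E = "- cball (0::complex) M"
  have E: "?E \<subseteq> - \<Gamma>"
    using M ball_subset_cball by blast
  have conE: "connected (g ` ?E)"
    using E g by (intro connected_continuous_image connected_complement_bounded_convex)
      (auto simp: homeomorphism_def intro: continuous_on_subset)
  have fg: "g v \<in> - K" "f (g v) = v" if "v \<in> ?E" for v
    using g E that by (metis homeomorphism_def imageI subsetD, metis homeomorphism_def subsetD)
  have gf: "w \<in> g ` ?E" if "w \<in> - K" "f w \<in> ?E" for w
    using g that by (metis homeomorphism_apply1 imageI)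
  have disj: "g ` ?E \<inter> sphere 0 R = {}"
  proof (rule ccontr)
    assume "g ` ?E \<inter> sphere 0 R \<noteq> {}"
    then obtain v where v: "v \<in> ?E" "g v \<in> sphere 0 R"
      by blast
    then have "v \<in> ball 0 M"
      using M fg by (metis UnI1 imageI subsetD)
    with v(1) show False
      by auto
  qed
  have "eventually (\<lambda>w. f w \<in> ?E \<and> norm w > R) at_infinity"
  proof (rule eventually_conj)
    show "eventually (\<lambda>w. f w \<in> ?E) at_infinity"
      using inf unfolding filterlim_at_infinity_conv_norm_at_top filterlim_at_top_dense
      by (simp add: not_le)
    show "eventually (\<lambda>w::complex. norm w > R) at_infinity"
      by (auto simp: eventually_at_infinity intro: exI[of _ "R + 1"])
  qed
  then obtain u where u: "f u \<in> ?E" "norm u > R"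
    using eventually_happens' trivial_limit_at_infinity by blast
  have "u \<in> g ` ?E - ball 0 R"
    using u R by (intro DiffI gf) auto
  then have "g ` ?E - ball 0 R \<noteq> {}"
    by (metis empty_iff)
  moreover have "g ` ?E \<inter> frontier (ball 0 R) = {}"
    using disj R by (simp add: frontier_ball)
  ultimately have far: "g ` ?E \<inter> ball 0 R = {}"
    using connected_Int_frontier[OF conE, of "ball 0 R"] by blast
  have "z \<in> K"
    using z \<open>compact K\<close> by (meson compact_imp_closed frontier_subset_closed subsetD)
  have "eventually (\<lambda>w. f w \<in> ?E) (at z)"
    using pole unfolding is_pole_def filterlim_at_infinity_conv_norm_at_top filterlim_at_top_dense
    by (simp add: not_le)
  moreover have "eventually (\<lambda>w. w \<in> ball 0 R) (at z)"
    using \<open>z \<in> K\<close> R by (intro eventually_at_in_open') auto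
  ultimately have "eventually (\<lambda>w. f w \<in> ?E \<and> w \<in> ball 0 R) (at z)"
    by (rule eventually_conj)
  then obtain N where N: "open N" "z \<in> N" "\<And>w. w \<in> N \<Longrightarrow> w \<noteq> z \<Longrightarrow> f w \<in> ?E \<and> w \<in> ball 0 R"
    unfolding eventually_at_topological by blast
  have "z \<in> closure (- K)"
    using z frontier_closures by blast
  then obtain w where "w \<in> - K" "w \<in> N"
    using N by (metis IntE closure_iff_nhds_not_empty ex_in_conv subset_refl)
  with N(3) \<open>z \<in> K\<close> have "w \<in> - K" "f w \<in> ?E" "w \<in> ball 0 R"
    by auto
  with gf far show False
    by blast
qed

text \<open>
  By compactness, the frontier of \<open>f ` D\<close> consists of values of \<open>f\<close> on the frontier of \<open>D\<close>. The
  connected set \<open>- \<Gamma>\<close> thus misses the frontier of \<open>f ` D\<close>, although it has points in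
  \<open>f ` D\<close> since \<open>\<Gamma>\<close> has empty interior, and points outside \<open>f ` D\<close> since it is unbounded.
\<close>

lemma no_open_map_with_boundary_in_nonseparating_set:
  fixes f :: "complex \<Rightarrow> complex"
  assumes "bounded D" "open D" "D \<noteq> {}" and cont: "continuous_on (closure D) f"
    and opn: "open (f ` D)"
    and fr: "f ` frontier D \<subseteq> \<Gamma>"
    and G: "compact \<Gamma>" "connected (- \<Gamma>)" "interior \<Gamma> = {}"
  shows False
proof -
  have comp: "compact (f ` closure D)"
    using \<open>bounded D\<close> cont by (intro compact_continuous_image) (auto simp: compact_closure)
  have sub: "closure (f ` D) \<subseteq> f ` closure D"
    using comp by (intro closure_minimal image_mono closure_subset) (simp add: compact_imp_closed)
  have "\<not> f ` D \<subseteq> \<Gamma>"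
    using G(3) opn \<open>D \<noteq> {}\<close> by (metis image_is_empty interior_maximal subset_empty)
  then have 1: "- \<Gamma> \<inter> f ` D \<noteq> {}"
    by auto
  have "bounded (f ` D \<union> \<Gamma>)"
    using bounded_subset[OF compact_imp_bounded[OF comp], of "f ` D"] G(1) closure_subset
    by (auto simp: compact_imp_bounded)
  then have 2: "- \<Gamma> - f ` D \<noteq> {}"
    by (metis Compl_Un Diff_eq compl_bot_eq double_compl inf_commute not_bounded_UNIV)
  obtain y where y: "y \<in> frontier (f ` D)" "y \<notin> \<Gamma>"
    using connected_Int_frontier[OF G(2) 1 2] by auto
  then have "y \<in> closure (f ` D)" "y \<notin> f ` D"
    using opn by (auto simp: frontier_def interior_open)
  with sub obtain x where "x \<in> closure D" "y = f x" "x \<notin> D"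
    by auto
  then show False
    using fr y(2) \<open>open D\<close> by (auto simp: frontier_def interior_open)
qed

section \<open>Conformal maps onto the complement of arcs\<close>

text \<open>
  The open mapping theorem applies because \<open>F\<close> is not constant on any nonempty open set: \<open>P - c Q\<close>
  has the same degree as \<open>P\<close>, hence only finitely many roots.
\<close>

lemma quotient_open_map:
  assumes F: "coprime_quotient F P Q" and deg: "degree Q < degree P"
    and D: "open D" "\<And>z. z \<in> D \<Longrightarrow> poly Q z \<noteq> 0"
  shows "open (F ` D)"
proof (rule open_mapping_thm2[where S = D])
  have Feq: "F = (\<lambda>z. poly P z / poly Q z)"
    using F unfolding coprime_quotient_def by auto
  show "F holomorphic_on D"
    unfolding Feq using D by (intro holomorphic_intros) auto
  fix X assume X: "open X" "X \<subseteq> D" "X \<noteq> {}"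
  show "\<not> F constant_on X"
  proof
    assume "F constant_on X"
    then obtain c where c: "\<And>z. z \<in> X \<Longrightarrow> F z = c"
      unfolding constant_on_def by auto
    have "X \<subseteq> {z. poly (P - smult c Q) z = 0}"
      using c X D by (force simp: Feq field_simps)
    moreover have "degree (P - smult c Q) = degree P"
      using deg degree_smult_le[of c Q]
      by (metis add_uminus_conv_diff degree_add_eq_left degree_minus le_less_trans)
    then have "P - smult c Q \<noteq> 0"
      using deg by auto
    ultimately have "finite X"
      using poly_roots_finite finite_subset by blast
    then show False
      using X finite_imp_not_open by blast
  qed
qed (use D in auto)

text \<open>
  The point \<open>\<infinity>\<close> is its own image and, by injectivity, the image of no other point. Removing it
  on both sides leaves a bijection between subsets of the plane.
\<close>

lemma sphere_map_injective_onto_plane: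
  assumes inj: "inj_on (sphere_map F) (- (Some ` K))"
    and im: "sphere_map F ` (- (Some ` K)) = - (Some ` \<Gamma>)"
    and None: "sphere_map F None = None"
  shows "\<And>z. z \<in> - K \<Longrightarrow> \<not> is_pole F z" "inj_on F (- K)" "F ` (- K) = - \<Gamma>"
proof -
  have dom: "None \<in> - (Some ` K)" "Some z \<in> - (Some ` K) \<longleftrightarrow> z \<in> - K" for z
    by auto
  show np: "\<not> is_pole F z" if "z \<in> - K" for z
  proof
    assume "is_pole F z"
    then have "sphere_map F (Some z) = sphere_map F None"
      unfolding None by simp
    from inj_onD[OF inj this] dom that show False
      by blast
  qed
  have sm: "sphere_map F (Some z) = Some (F z)" if "z \<in> - K" for z
    using np[OF that] by simp
  show "inj_on F (- K)"
  proof (rule inj_onI)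
    fix x y assume xy: "x \<in> - K" "y \<in> - K" "F x = F y"
    then have "sphere_map F (Some x) = sphere_map F (Some y)"
      by (simp only: sm)
    from inj_onD[OF inj this] dom xy show "x = y"
      by blast
  qed
  show "F ` (- K) = - \<Gamma>"
  proof (intro equalityI subsetI)
    fix y assume "y \<in> F ` (- K)"
    then obtain x where x: "x \<in> - K" "y = F x"
      by blast
    then have "Some y \<in> sphere_map F ` (- (Some ` K))"
      using sm dom by (metis imageI)
    then show "y \<in> - \<Gamma>"
      unfolding im by blast
  next
    fix y assume "y \<in> - \<Gamma>"
    then have "Some y \<in> sphere_map F ` (- (Some ` K))"
      unfolding im by blast
    then obtain p where p: "p \<in> - (Some ` K)" "Some y = sphere_map F p"
      by blast
    then obtain x where x: "p = Some x"
      using None by (metis option.exhaust option.distinct(1))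
    then have "x \<in> - K"
      using p(1) dom by blast
    moreover from this have "y = F x"
      using p(2) x sm by (metis option.inject)
    ultimately show "y \<in> F ` (- K)"
      by blast
  qed
qed

lemma quotient_maps_frontier_into_omitted_set:
  assumes F: "coprime_quotient F P Q" and inf: "filterlim F at_infinity at_infinity"
    and K: "compact K" and \<Gamma>: "compact \<Gamma>"
    and np: "\<And>z. z \<in> - K \<Longrightarrow> \<not> is_pole F z" and inj: "inj_on F (- K)" and im: "F ` (- K) = - \<Gamma>"
    and z: "z \<in> frontier K"
  shows "poly Q z \<noteq> 0" "F z \<in> \<Gamma>"
proof -
  have openQ: "open {z. poly Q z \<noteq> 0}"
    by (intro open_Collect_neq continuous_intros)
  have openK: "open (- K)"
    using K by (simp add: compact_imp_closed open_Compl)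
  have "- K \<subseteq> {z. poly Q z \<noteq> 0}"
    using np is_pole_coprime_quotient_iff[OF F] by blast
  then have holK: "F holomorphic_on (- K)"
    by (rule holomorphic_on_subset[OF coprime_quotient_holomorphic_on[OF F]])
  show Qz: "poly Q z \<noteq> 0"
    using no_pole_on_frontier[OF K \<Gamma> holomorphic_on_imp_continuous_on[OF holK] inj im inf z]
      is_pole_coprime_quotient_iff[OF F] by blast
  have "continuous_on {z. poly Q z \<noteq> 0} F"
    using coprime_quotient_holomorphic_on[OF F] by (rule holomorphic_on_imp_continuous_on)
  then have "isCont F z"
    using openQ Qz by (simp add: continuous_on_eq_continuous_at)
  then have "F z \<notin> F ` (- K)"
    using z by (intro injective_holomorphic_frontier_value[OF holK openK inj])
      (simp_all add: frontier_complement)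
  with im show "F z \<in> \<Gamma>"
    by auto
qed

text \<open>
  The insides of the \<open>n\<close> frontier curves are disjoint and each of them contains a zero of \<open>Q\<close>.
\<close>

lemma kind_A_rsquarefree_denominator:
  assumes F: "coprime_quotient F P Q" and deg: "degree P = n + 1" "degree Q = n"
    and arcs: "\<forall>j\<in>{1..n}. jordan_arc (\<gamma> j)" "disjoint_family_on \<gamma> {1..n}"
    and A: "kind_A n \<gamma> F"
  shows "rsquarefree Q"
proof -
  define \<Gamma> where "\<Gamma> = (\<Union>j\<in>{1..n}. \<gamma> j)"
  have G: "compact \<Gamma>" "connected (- \<Gamma>)" "interior \<Gamma> = {}"
    using disjoint_jordan_arcs_nonseparating[of "{1..n}" \<gamma>] arcs by (auto simp: \<Gamma>_def)
  obtain K C where K: "compact K" and C: "\<And>j. j \<in> {1..n} \<Longrightarrow> jordan_curve (C j)"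
    and disjC: "disjoint_family_on C {1..n}" and frK: "frontier K = (\<Union>j\<in>{1..n}. C j)"
    and sinj: "inj_on (sphere_map F) (- (Some ` K))"
    and sim: "sphere_map F ` (- (Some ` K)) = - (Some ` \<Gamma>)"
    and None: "sphere_map F None = None"
    using A unfolding kind_A_def bounded_by_jordan_curves_def conformal_map_onto_def \<Gamma>_def
    by metis
  note plane = sphere_map_injective_onto_plane[OF sinj sim None]
  have inf: "filterlim F at_infinity at_infinity"
    using None by (auto split: if_splits)
  have holF: "F holomorphic_on {z. poly Q z \<noteq> 0}"
    by (rule coprime_quotient_holomorphic_on[OF F])
  have conK: "connected (- K)"
  proof -
    have "- K \<subseteq> {z. poly Q z \<noteq> 0}"
      using plane(1) is_pole_coprime_quotient_iff[OF F] by blast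
    then have "continuous_on (- K) F"
      using holF by (meson continuous_on_subset holomorphic_on_imp_continuous_on)
    moreover have "open (- K)"
      using K by (simp add: compact_imp_closed open_Compl)
    ultimately obtain g where "homeomorphism (- K) (- \<Gamma>) F g"
      using invariance_of_domain_homeomorphism[of "- K" F] plane(2,3) by auto
    then show ?thesis
      using G(2) by (metis connected_continuous_image homeomorphism_def)
  qed
  have front: "poly Q z \<noteq> 0" "F z \<in> \<Gamma>" if "z \<in> frontier K" for z
    using quotient_maps_frontier_into_omitted_set[OF F inf K G(1) plane that] by blast+
  have compC: "compact (C j)" "inside (C j) \<noteq> {}" if "j \<in> {1..n}" for j
    using jordan_curve_inside_nonempty[OF C[OF that]] by blast+
  have clC: "closed (C j)" if "j \<in> {1..n}" for j
    using compC[OF that] by (simp add: compact_imp_closed)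

  have "\<exists>z. z \<in> inside (C j) \<and> poly Q z = 0" if j: "j \<in> {1..n}" for j
  proof (rule ccontr)
    let ?D = "inside (C j)"
    assume "\<not> (\<exists>z. z \<in> ?D \<and> poly Q z = 0)"
    then have nz: "poly Q z \<noteq> 0" if "z \<in> ?D" for z
      using that by blast
    have opD: "open ?D"
      using clC[OF j] by (rule open_inside)
    have fr: "frontier ?D \<subseteq> frontier K"
      using frontier_inside_subset[OF clC[OF j]] frK j by auto
    have "closure ?D \<subseteq> ?D \<union> frontier ?D"
      using closure_Un_frontier by blast
    then have "closure ?D \<subseteq> {z. poly Q z \<noteq> 0}"
      using nz fr front(1) by blast
    then have "continuous_on (closure ?D) F"
      using holF by (meson continuous_on_subset holomorphic_on_imp_continuous_on)
    moreover have "bounded ?D"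
      using compC(1)[OF j] by (simp add: bounded_inside compact_imp_bounded)
    moreover have "open (F ` ?D)"
      using quotient_open_map[OF F _ opD] deg nz by simp
    moreover have "F ` frontier ?D \<subseteq> \<Gamma>"
      using fr front(2) by blast
    ultimately show False
      using no_open_map_with_boundary_in_nonseparating_set[of ?D F \<Gamma>] opD compC(2)[OF j] G
      by blast
  qed
  then obtain p where p: "\<And>j. j \<in> {1..n} \<Longrightarrow> p j \<in> inside (C j) \<and> poly Q (p j) = 0"
    by metis
  have "disjoint_family_on (\<lambda>j. inside (C j)) {1..n}"
    using disjoint_insides_of_frontier_curves[OF K conK _ disjC frK] clC by blast
  then have "inj_on p {1..n}"
    using p by (intro inj_onI) (metis disjoint_family_on_def disjoint_iff)
  then have "card (p ` {1..n}) = n"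
    by (simp add: card_image)
  moreover have Q0: "Q \<noteq> 0"
    using F by (simp add: coprime_quotient_def)
  moreover have "card (p ` {1..n}) \<le> card {z. poly Q z = 0}"
    using p by (intro card_mono poly_roots_finite[OF Q0]) auto
  ultimately show ?thesis
    using rsquarefree_if_enough_roots[OF Q0] deg by simp
qed

theorem proposition1p4:
  fixes n :: nat and F :: "complex \<Rightarrow> complex"
    and \<gamma> :: "nat \<Rightarrow> complex set" and \<eta> \<zeta> :: "nat \<Rightarrow> complex"
  assumes "n \<ge> 1"
    and "((\<forall>j\<in>{1..n}. jordan_arc (\<gamma> j)) \<and> disjoint_family_on \<gamma> {1..n} \<and> kind_A n \<gamma> F)
       \<or> (inj_on \<eta> {1..2 * n} \<and> kind_B n \<eta> F)
       \<or> (inj_on \<zeta> {1..2 * n} \<and> kind_C n \<zeta> F)"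
  shows "(\<forall>P Q. coprime_quotient F P Q \<longrightarrow> \<not> degree P < n + 1 \<and> \<not> degree Q < n)
       \<and> only_simple_poles F"
proof -
  have "rational_of_type F (n + 1) n"
    using assms(2) unfolding kind_A_def kind_B_def kind_C_def by blast
  then obtain P Q where F: "coprime_quotient F P Q" and deg: "degree P = n + 1" "degree Q = n"
    unfolding rational_of_type_def by blast
  have fin: "finite (critical_points F)"
    using finite_critical_points_quotient[OF F] deg by simp
  have "rsquarefree Q"
    using assms(2)
  proof (elim disjE conjE)
    assume "\<forall>j\<in>{1..n}. jordan_arc (\<gamma> j)" "disjoint_family_on \<gamma> {1..n}" "kind_A n \<gamma> F"
    then show ?thesis
      by (rule kind_A_rsquarefree_denominator[OF F deg])
  next
    assume "inj_on \<eta> {1..2 * n}" "kind_B n \<eta> F"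
    then have "card (critical_values F) = 2 * n"
      by (simp add: kind_B_def card_image)
    then have "2 * n \<le> card (critical_points F)"
      using card_image_le[OF fin, of F] by (simp add: critical_values_def)
    then show ?thesis
      using rsquarefree_denominator_if_many_critical_points[OF F] deg by simp
  next
    assume "inj_on \<zeta> {1..2 * n}" "kind_C n \<zeta> F"
    then have "card (critical_points F) = 2 * n"
      by (simp add: kind_C_def card_image)
    then show ?thesis
      using rsquarefree_denominator_if_many_critical_points[OF F] deg by simp
  qed
  then have "only_simple_poles F"
    using only_simple_poles_quotient[OF F] deg by simp
  moreover have "degree P' = n + 1 \<and> degree Q' = n" if "coprime_quotient F P' Q'" for P' Q'
    using coprime_quotient_degree_unique[OF F that] deg by simp
  ultimately show ?thesis
    by force
qed

end
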